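(* Let $p\ge1$ be an integer, $L,\mu>0$, let $\mathcal X\subseteq\mathbb R^d$ be closed, convex and bounded with diameter $D>0$, and let $F:\mathbb R^d\to\mathbb R^d$ be $(p-1)^{\text{th}}$-order $L$-smooth and $\mu$-strongly monotone. Let $\kappa=L/\mu$ and let $x^\star\in\mathcal X$ be the unique weak solution of the VI, i.e. the unique point of $\mathcal X$ with $\langle F(x),x-x^\star\rangle\ge0$ for all $x\in\mathcal X$. Let $x_0\in\mathcal X$ and let $\{x_k\}_{k=0}^{T+1}$ be generated by $\mathsf{Perseus\text{-}restart}(p,x_0,L,\mu,D,T,1)$. Then for all $k$ with $0\le k\le T$, $$\|x_{k+1}-x^\star\|\le\sqrt{\tfrac{2^p(5p-2)\kappa}{p!}}\;\|x_k-x^\star\|^{\frac{p+1}{2}}.$$ As a consequence, if $p\ge2$ and $$\|x_0-x^\star\|\le\tfrac12\Big(\tfrac{p!}{2^p(5p-2)\kappa}\Big)^{\frac1{p-1}},$$ then the iterates $x_k$ converge to $x^\star$ at least superlinearly; that is, when the scheme is run indefinitely, $x_k\to x^\star$ and either $x_k=x^\star$ for all large $k$ or $\|x_{k+1}-x^\star\|/\|x_k-x^\star\|\to0$.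
   Context: Norms are Euclidean. The diameter is $D=\max_{x,x'\in\mathcal X}\|x-x'\|$. $F$ is $(p-1)^{\text{th}}$-order $L$-smooth if it is $(p-1)$ times continuously differentiable and $\|\nabla^{(p-1)}F(x)-\nabla^{(p-1)}F(x')\|_{\mathrm{op}}\le L\|x-x'\|$ for all $x,x'\in\mathbb R^d$ (operator norm of multilinear maps; $\nabla^{(0)}F=F$). $F$ is $\mu$-strongly monotone if $\langle F(x)-F(x'),x-x'\rangle\ge\mu\|x-x'\|^2$ for all $x,x'\in\mathbb R^d$. For $v\in\mathcal X$ define $$F_v(x)=\sum_{j=0}^{p-1}\tfrac1{j!}\nabla^{(j)}F(v)[x-v]^j+\tfrac{5L}{(p-1)!}\|x-v\|^{p-1}(x-v)$$ (for $p=1$: $F_v(x)=F(v)+5L(x-v)$). Method $\mathsf{Perseus}(p,x_0,L,T,\mathsf{opt})$ with $\mathsf{opt}=1$. Set $s_0=0$. For $k=0,1,\dots,T-1$: (1) if $x_k$ is a solution of the VI, i.e. $\langle F(x_k),x-x_k\rangle\ge0$ for all $x\in\mathcal X$, stop and return $x_k$; (2) $v_{k+1}=\operatorname{argmax}_{v\in\mathcal X}\{\langle s_k,v-x_0\rangle-\frac12\|v-x_0\|^2\}$; (3) (one call of the subproblem solver) take any $x_{k+1}\in\mathcal X$ with $\sup_{x\in\mathcal X}\langle F_{v_{k+1}}(x_{k+1}),x_{k+1}-x\rangle\le\frac{L}{p!}\|x_{k+1}-v_{k+1}\|^{p+1}$; (4) take any $\lambda_{k+1}>0$ with $\frac1{20p-8}\le\frac{\lambda_{k+1}L\|x_{k+1}-v_{k+1}\|^{p-1}}{p!}\le\frac1{10p+2}$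 (with the convention $t^0=1$; if $p\ge2$ and $x_{k+1}=v_{k+1}$, then $x_{k+1}$ is a solution of the VI and the method stops and returns it); (5) $s_{k+1}=s_k-\lambda_{k+1}F(x_{k+1})$. If it did not stop early, the output is $x_T$. Method $\mathsf{Perseus\text{-}restart}(p,x_0,L,\mu,D,T,1)$. For $k=0,1,\dots,T$: if $x_k$ is a solution of the VI, stop (all later iterates are then set equal to $x_k$); otherwise let $x_{k+1}$ be an output of $\mathsf{Perseus}(p,x_k,L,1,1)$, i.e. one inner iteration started afresh at $x_k$ with zero dual variable. *)

theory Defs
  imports "HOL-Analysis.Analysis"
begin

text \<open>
  The derivative of order \<open>j\<close> at \<open>x\<close>, evaluated on the directions \<open>h\<^sub>1, \<dots>, h\<^sub>j\<close>, is
  \<open>hderiv F [h\<^sub>1, \<dots>, h\<^sub>j] x\<close>; the last direction in the list is differentiated first.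
\<close>

primrec hderiv ::
  "('a::euclidean_space \<Rightarrow> 'b::euclidean_space) \<Rightarrow> 'a list \<Rightarrow> 'a \<Rightarrow> 'b" where
  "hderiv F [] = F"
| "hderiv F (h # hs) = (\<lambda>x. frechet_derivative (hderiv F hs) (at x) h)"

text \<open>
  In finite dimension, differentiability and continuity of a multilinear-map-valued function
  (in operator norm) amount to differentiability and continuity of its value on every fixed
  tuple of directions.
\<close>

definition times_cont_diff ::
  "nat \<Rightarrow> ('a::euclidean_space \<Rightarrow> 'b::euclidean_space) \<Rightarrow> bool" where
  "times_cont_diff m F \<longleftrightarrow>
     (\<forall>hs. length hs < m \<longrightarrow> (\<forall>x. hderiv F hs differentiable (at x))) \<and>
     (\<forall>hs. length hs = m \<longrightarrow> continuous_on UNIV (hderiv F hs))"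

definition multi_onorm ::
  "nat \<Rightarrow> ('a::euclidean_space list \<Rightarrow> 'b::euclidean_space) \<Rightarrow> real" where
  "multi_onorm m A =
     (SUP hs\<in>{hs. length hs = m \<and> (\<forall>h\<in>set hs. norm h = 1)}. norm (A hs))"

definition order_smooth ::
  "nat \<Rightarrow> real \<Rightarrow> ('a::euclidean_space \<Rightarrow> 'b::euclidean_space) \<Rightarrow> bool" where
  "order_smooth m L F \<longleftrightarrow> times_cont_diff m F \<and>
     (\<forall>x x'. multi_onorm m (\<lambda>hs. hderiv F hs x - hderiv F hs x') \<le> L * norm (x - x'))"

definition strongly_monotone :: "real \<Rightarrow> ('a::euclidean_space \<Rightarrow> 'a) \<Rightarrow> bool" where
  "strongly_monotone \<mu> F \<longleftrightarrow>
     (\<forall>x x'. (F x - F x') \<bullet> (x - x') \<ge> \<mu> * (norm (x - x'))\<^sup>2)"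

definition vi_solution :: "('a::euclidean_space \<Rightarrow> 'a) \<Rightarrow> 'a set \<Rightarrow> 'a \<Rightarrow> bool" where
  "vi_solution F X z \<longleftrightarrow> z \<in> X \<and> (\<forall>x\<in>X. F z \<bullet> (x - z) \<ge> 0)"

definition weak_vi_solution :: "('a::euclidean_space \<Rightarrow> 'a) \<Rightarrow> 'a set \<Rightarrow> 'a \<Rightarrow> bool" where
  "weak_vi_solution F X z \<longleftrightarrow> z \<in> X \<and> (\<forall>x\<in>X. F x \<bullet> (x - z) \<ge> 0)"

definition reg_taylor ::
  "nat \<Rightarrow> real \<Rightarrow> ('a::euclidean_space \<Rightarrow> 'a) \<Rightarrow> 'a \<Rightarrow> 'a \<Rightarrow> 'a" where
  "reg_taylor p L F v x =
     (\<Sum>j = 0..p - 1. (1 / fact j) *\<^sub>R hderiv F (replicate j (x - v)) v)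
     + ((5 * L / fact (p - 1)) * norm (x - v) ^ (p - 1)) *\<^sub>R (x - v)"

definition dual_argmax :: "'a::euclidean_space set \<Rightarrow> 'a \<Rightarrow> 'a \<Rightarrow> 'a \<Rightarrow> bool" where
  "dual_argmax X x0 s v \<longleftrightarrow>
     is_arg_max (\<lambda>w. s \<bullet> (w - x0) - 1/2 * (norm (w - x0))\<^sup>2) (\<lambda>w. w \<in> X) v"

definition subproblem_solution ::
  "nat \<Rightarrow> real \<Rightarrow> ('a::euclidean_space \<Rightarrow> 'a) \<Rightarrow> 'a set \<Rightarrow> 'a \<Rightarrow> 'a \<Rightarrow> bool" where
  "subproblem_solution p L F X v y \<longleftrightarrow> y \<in> X \<and>
     (SUP x\<in>X. reg_taylor p L F v y \<bullet> (y - x)) \<le> L / fact p * norm (y - v) ^ (p + 1)"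

text \<open>
  The method is nondeterministic, so it is a relation:
  \<open>perseus_run p L F X x0 n x s z\<close> says that \<open>z\<close> is a possible output when the current
  iterate is \<open>x\<close>, the current dual variable is \<open>s\<close>, and \<open>n\<close> iterations remain.
\<close>

inductive perseus_run ::
  "nat \<Rightarrow> real \<Rightarrow> ('a::euclidean_space \<Rightarrow> 'a) \<Rightarrow> 'a set \<Rightarrow> 'a \<Rightarrow> nat \<Rightarrow> 'a \<Rightarrow> 'a \<Rightarrow> 'a \<Rightarrow> bool"
  for p L F X x0 where
  finished: "perseus_run p L F X x0 0 x s x"
| stop_solution: "vi_solution F X x \<Longrightarrow> perseus_run p L F X x0 (Suc n) x s x"
| stop_stationary:
    "\<not> vi_solution F X x \<Longrightarrow> dual_argmax X x0 s v \<Longrightarrow> subproblem_solution p L F X v y \<Longrightarrow>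
     p \<ge> 2 \<Longrightarrow> y = v \<Longrightarrow> perseus_run p L F X x0 (Suc n) x s y"
| step:
    "\<not> vi_solution F X x \<Longrightarrow> dual_argmax X x0 s v \<Longrightarrow> subproblem_solution p L F X v y \<Longrightarrow>
     \<not> (p \<ge> 2 \<and> y = v) \<Longrightarrow> lam > 0 \<Longrightarrow>
     1 / (20 * real p - 8) \<le> lam * L * norm (y - v) ^ (p - 1) / fact p \<Longrightarrow>
     lam * L * norm (y - v) ^ (p - 1) / fact p \<le> 1 / (10 * real p + 2) \<Longrightarrow>
     perseus_run p L F X x0 n y (s - lam *\<^sub>R F y) z \<Longrightarrow>
     perseus_run p L F X x0 (Suc n) x s z"

definition perseus ::
  "nat \<Rightarrow> real \<Rightarrow> ('a::euclidean_space \<Rightarrow> 'a) \<Rightarrow> 'a set \<Rightarrow> 'a \<Rightarrow> nat \<Rightarrow> 'a \<Rightarrow> bool" where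
  "perseus p L F X x0 T z \<longleftrightarrow> perseus_run p L F X x0 T x0 0 z"

text \<open>
  Only \<open>x 0, \<dots>, x (T + 1)\<close> are constrained. Stopping at a solution freezes all later
  iterates, since the repeated point is again a solution. The inputs \<open>\<mu>\<close> and \<open>D\<close> of the
  restart scheme do not influence the iterates and are omitted.
\<close>

definition perseus_restart ::
  "nat \<Rightarrow> real \<Rightarrow> ('a::euclidean_space \<Rightarrow> 'a) \<Rightarrow> 'a set \<Rightarrow> 'a \<Rightarrow> nat \<Rightarrow> (nat \<Rightarrow> 'a) \<Rightarrow> bool" where
  "perseus_restart p L F X x0 T x \<longleftrightarrow> x 0 = x0 \<and>
     (\<forall>k\<le>T. if vi_solution F X (x k) then x (Suc k) = x k
            else perseus p L F X (x k) 1 (x (Suc k)))"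

end

theory Submission
  imports Defs
begin

text \<open>
  Write \<open>v\<close> for an iterate, \<open>y\<close> for the next one, \<open>r = norm (y - v)\<close> and \<open>b = norm (v - xs)\<close>. Every
  restart begins with zero dual variable, so the dual step returns \<open>v\<close> itself, and \<open>y\<close> is an
  approximate solution of the variational inequality for the regularised Taylor model of \<open>F\<close> at \<open>v\<close>
  (\<open>perseus_one_iteration_cases\<close>).

  The weak solution \<open>xs\<close> is a solution by Minty's lemma, so strong monotonicity gives
  \<open>\<mu> (norm (y - xs))\<^sup>2 \<le> F y \<bullet> (y - xs)\<close> (\<open>strongly_monotone_solution_gap\<close>). Replacing \<open>F y\<close> by the
  model costs a Taylor remainder (\<open>order_smooth_taylor_remainder\<close>), the model itself contributes at
  most the accuracy of the subproblem solution, and the regularisation penalises long steps: it adds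
  at most \<open>- 5 p L / p! r\<^bsup>p-1\<^esup> (r\<^sup>2 - r b)\<close>. Altogether
    \<open>\<mu> (norm (y - xs))\<^sup>2 \<le> L / p! ((5 p + 1) r\<^sup>p b - (5 p - 2) r\<^bsup>p+1\<^esup>)\<close>.
  The step length \<open>r\<close> is not known, but the right-hand side is nonpositive for \<open>r \<ge> 2 b\<close>, and
  maximising over \<open>r\<close> leaves at most \<open>L / p! (5 p - 2) 2\<^sup>p b\<^bsup>p+1\<^esup>\<close>
  (\<open>subproblem_solution_contraction\<close>). Taking square roots is the one-step estimate.

  With \<open>C\<close> denoting the square of its constant, the estimate reads
  \<open>norm (y - xs) \<le> q b\<close> with \<open>q = sqrt C * b powr ((p - 1) / 2)\<close>. For \<open>p \<ge> 2\<close> the exponent is positive,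
  and the condition on the starting point makes \<open>q\<close> at most \<open>(1 / 2) powr ((p - 1) / 2) < 1\<close> there. The
  errors then decrease geometrically, so the factors \<open>q\<close> themselves tend to \<open>0\<close>
  (\<open>superlinear_convergence\<close>).
\<close>

section \<open>Iterated derivatives are multilinear\<close>

lemma hderiv_has_derivative:
  assumes "times_cont_diff m F" and "length hs < m"
  shows "(hderiv F hs has_derivative (\<lambda>h. hderiv F (h # hs) x)) (at x)"
  using assms by (simp add: times_cont_diff_def frechet_derivative_works)

text \<open>
  Differentiation is linear in the function, so linearity in an inner direction survives every
  further differentiation: the functions \<open>hderiv F (pre @ h # post)\<close> depend linearly on \<open>h\<close> at every
  point, hence so do their derivatives.
\<close>

lemma hderiv_multilinear:
  assumes "times_cont_diff m F" and "length pre + length post < m"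
  shows "linear (\<lambda>h. hderiv F (pre @ h # post) x)"
  using assms(2)
proof (induction pre arbitrary: x)
  case Nil
  then show ?case
    using has_derivative_linear[OF hderiv_has_derivative[OF assms(1)]] by simp
next
  case (Cons a pre)
  have der: "(hderiv F (pre @ h # post) has_derivative (\<lambda>e. hderiv F (e # pre @ h # post) x)) (at x)"
    for h using Cons.prems by (intro hderiv_has_derivative[OF assms(1)]) simp
  have lin: "linear (\<lambda>h. hderiv F (pre @ h # post) z)" for z
    using Cons by simp
  have add: "hderiv F (a # pre @ (h + k) # post) x
      = hderiv F (a # pre @ h # post) x + hderiv F (a # pre @ k # post) x" for h k
  proof -
    have "hderiv F (pre @ (h + k) # post)
        = (\<lambda>z. hderiv F (pre @ h # post) z + hderiv F (pre @ k # post) z)"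
      by (rule ext) (rule linear_add[OF lin])
    from has_derivative_unique[OF der[of "h + k", unfolded this]
        has_derivative_add[OF der[of h] der[of k]]]
    show ?thesis by (rule fun_cong)
  qed
  have "hderiv F (a # pre @ (c *\<^sub>R h) # post) x
      = c *\<^sub>R hderiv F (a # pre @ h # post) x" for c h
  proof -
    have "hderiv F (pre @ (c *\<^sub>R h) # post) = (\<lambda>z. c *\<^sub>R hderiv F (pre @ h # post) z)"
      by (rule ext) (rule linear_scale[OF lin])
    from has_derivative_unique[OF der[of "c *\<^sub>R h", unfolded this]
        has_derivative_scaleR_right[OF der[of h], of c]]
    show ?thesis by (rule fun_cong)
  qed
  with add show ?case by (intro linearI) simp_all
qed

text \<open>
  The operator norm \<^const>\<open>multi_onorm\<close> is a supremum over tuples of unit vectors, and a supremum of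
  reals dominates its members only if these are bounded above. Multilinear maps in finite dimension
  provide the bound: expand the first direction in the basis, its coordinates being at most \<open>1\<close>.
\<close>

lemma multilinear_bounded_on_unit_vectors:
  fixes A :: "'a::euclidean_space list \<Rightarrow> 'b::real_normed_vector"
  assumes "\<And>pre post. length pre + length post + 1 = m \<Longrightarrow> linear (\<lambda>h. A (pre @ h # post))"
  shows "\<exists>B. \<forall>hs. length hs = m \<and> (\<forall>h\<in>set hs. norm h = 1) \<longrightarrow> norm (A hs) \<le> B"
  using assms
proof (induction m arbitrary: A)
  case 0
  show ?case by auto
next
  case (Suc m)
  have "\<exists>B. \<forall>hs. length hs = m \<and> (\<forall>h\<in>set hs. norm h = 1) \<longrightarrow> norm (A (b # hs)) \<le> B" for b
    using Suc.prems[of "b # _"] by (intro Suc.IH) auto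
  then obtain B where
    B: "\<And>b hs. length hs = m \<Longrightarrow> \<forall>h\<in>set hs. norm h = 1 \<Longrightarrow> norm (A (b # hs)) \<le> B b"
    by metis
  have "norm (A hs) \<le> (\<Sum>b\<in>Basis. B b)"
    if hs: "length hs = Suc m" "\<forall>h\<in>set hs. norm h = 1" for hs
  proof -
    obtain e es where es: "hs = e # es" using hs(1) by (cases hs) auto
    have lin: "linear (\<lambda>h. A (h # es))"
      using Suc.prems[of "[]" es] hs(1) es by simp
    have "A hs = A ((\<Sum>b\<in>Basis. (e \<bullet> b) *\<^sub>R b) # es)"
      by (simp add: es euclidean_representation)
    also have "\<dots> = (\<Sum>b\<in>Basis. (e \<bullet> b) *\<^sub>R A (b # es))"
      by (simp add: linear_sum[OF lin] linear_scale[OF lin])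
    also have "norm \<dots> \<le> (\<Sum>b\<in>Basis. B b)"
    proof (rule sum_norm_le)
      fix b :: 'a assume b: "b \<in> Basis"
      have "\<bar>e \<bullet> b\<bar> \<le> 1" using Basis_le_norm[OF b, of e] hs es by simp
      moreover have "norm (A (b # es)) \<le> B b" using B[of es b] hs es by simp
      ultimately have "\<bar>e \<bullet> b\<bar> * norm (A (b # es)) \<le> 1 * B b" by (intro mult_mono) auto
      then show "norm ((e \<bullet> b) *\<^sub>R A (b # es)) \<le> B b" by simp
    qed
    finally show ?thesis .
  qed
  then show ?case by blast
qed

text \<open>
  Smoothness bounds an operator norm, whereas the Taylor estimate along a segment needs the bound for
  one tuple of directions.
\<close>

lemma order_smooth_hderiv_lipschitz:
  assumes "order_smooth m L F" and "length hs = m" and "\<And>h. h \<in> set hs \<Longrightarrow> norm h = 1"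
  shows "norm (hderiv F hs x - hderiv F hs x') \<le> L * norm (x - x')"
proof -
  let ?A = "\<lambda>hs. hderiv F hs x - hderiv F hs x'"
  let ?U = "{hs. length hs = m \<and> (\<forall>h\<in>set hs. norm h = 1)}"
  have tcd: "times_cont_diff m F" using assms(1) by (simp add: order_smooth_def)
  have "\<exists>B. \<forall>hs. length hs = m \<and> (\<forall>h\<in>set hs. norm h = 1) \<longrightarrow> norm (?A hs) \<le> B"
    by (intro multilinear_bounded_on_unit_vectors linear_compose_sub hderiv_multilinear[OF tcd]) auto
  then have "bdd_above ((\<lambda>hs. norm (?A hs)) ` ?U)" by (auto simp: bdd_above_def)
  then have "norm (?A hs) \<le> multi_onorm m ?A"
    unfolding multi_onorm_def using assms(2,3) by (intro cSUP_upper) auto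
  also have "\<dots> \<le> L * norm (x - x')" using assms(1) by (simp add: order_smooth_def)
  finally show ?thesis .
qed

lemma hderiv_replicate_scaleR:
  assumes "times_cont_diff m F" and "j \<le> m"
  shows "hderiv F (replicate j (c *\<^sub>R u)) x = c ^ j *\<^sub>R hderiv F (replicate j u) x"
  using assms(2)
proof (induction j arbitrary: x)
  case 0
  show ?case by simp
next
  case (Suc j)
  have der: "(hderiv F (replicate j w) has_derivative (\<lambda>h. hderiv F (h # replicate j w) x)) (at x)" for w
    using Suc.prems by (intro hderiv_has_derivative[OF assms(1)]) simp
  have "hderiv F (replicate j (c *\<^sub>R u)) = (\<lambda>z. c ^ j *\<^sub>R hderiv F (replicate j u) z)"
    using Suc by auto
  from has_derivative_unique[OF der[of "c *\<^sub>R u", unfolded this]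
      has_derivative_scaleR_right[OF der[of u], of "c ^ j"]]
  have "hderiv F (h # replicate j (c *\<^sub>R u)) x = c ^ j *\<^sub>R hderiv F (h # replicate j u) x" for h
    by (rule fun_cong)
  then show ?case
    using linear_scale[OF has_derivative_linear[OF der[of u]], of c u]
    by (simp del: hderiv.simps add: mult.commute)
qed

section \<open>Taylor remainder of a smooth operator\<close>

text \<open>
  A Lipschitz bound on the derivative of order \<open>m\<close> stands in for a derivative of order \<open>m + 1\<close>. The
  remainder vanishes at \<open>0\<close> and its derivative is the remainder of \<open>G 1\<close> of order one less, so
  the mean value inequality integrates the bound once per induction step. The chain \<open>G\<close> is kept
  abstract so that it can be shifted.
\<close>

lemma taylor_remainder_lipschitz:
  fixes G :: "nat \<Rightarrow> real \<Rightarrow> 'b::real_normed_vector"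
  assumes "\<And>j t. j < m \<Longrightarrow> (G j has_vector_derivative G (Suc j) t) (at t)"
    and "\<And>t. t \<ge> 0 \<Longrightarrow> norm (G m t - G m 0) \<le> L * t"
    and "t \<ge> 0"
  shows "norm (G 0 t - (\<Sum>j\<le>m. (t ^ j / fact j) *\<^sub>R G j 0)) \<le> L * t ^ Suc m / fact (Suc m)"
  using assms
proof (induction m arbitrary: G t)
  case 0
  then show ?case by simp
next
  case (Suc m)
  define E where "E s = G 0 s - (\<Sum>j\<le>Suc m. (s ^ j / fact j) *\<^sub>R G j 0)" for s
  define E' where "E' s = G 1 s - (\<Sum>j\<le>m. (s ^ j / fact j) *\<^sub>R G (Suc j) 0)" for s
  define \<phi> where "\<phi> s = L * s ^ Suc (Suc m) / fact (Suc (Suc m))" for s :: real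
  have IH: "norm (E' s) \<le> L * s ^ Suc m / fact (Suc m)" if "s \<ge> 0" for s
    using Suc.IH[of "\<lambda>j. G (Suc j)" s] Suc.prems(1)[of "Suc _"] Suc.prems(2) that
    by (simp add: E'_def)
  have "E s = G 0 s - (G 0 0 + (\<Sum>j\<le>m. (s ^ Suc j / fact (Suc j)) *\<^sub>R G (Suc j) 0))" for s
    unfolding E_def by (subst sum.atMost_Suc_shift) simp
  then have E: "E = (\<lambda>s. G 0 s - (G 0 0 + (\<Sum>j\<le>m. (s ^ Suc j / fact (Suc j)) *\<^sub>R G (Suc j) 0)))"
    by blast
  have pow: "((\<lambda>s. s ^ Suc j / fact (Suc j)) has_real_derivative s ^ j / fact j) (at s)" for j s
  proof -
    have "real (Suc j) * s ^ (Suc j - Suc 0) / fact (Suc j) = s ^ j / fact j"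
      by (simp del: of_nat_Suc)
    with DERIV_cdivide[OF DERIV_pow[of "Suc j" s], of "fact (Suc j)"] show ?thesis by simp
  qed
  have E': "(E has_vector_derivative E' s) (at s)" for s
  proof -
    have "((\<lambda>s. (s ^ Suc j / fact (Suc j)) *\<^sub>R G (Suc j) 0) has_vector_derivative
        (s ^ j / fact j) *\<^sub>R G (Suc j) 0) (at s)" for j
      using has_vector_derivative_scaleR[OF pow has_vector_derivative_const] by simp
    then have "((\<lambda>s. \<Sum>j\<le>m. (s ^ Suc j / fact (Suc j)) *\<^sub>R G (Suc j) 0) has_vector_derivative
        (\<Sum>j\<le>m. (s ^ j / fact j) *\<^sub>R G (Suc j) 0)) (at s)"
      by (intro has_vector_derivative_sum)
    from has_vector_derivative_diff[OF Suc.prems(1)[of 0 s]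
        has_vector_derivative_add[OF has_vector_derivative_const this, of "G 0 0"]]
    show ?thesis unfolding E E'_def by simp
  qed
  have \<phi>': "(\<phi> has_vector_derivative L * s ^ Suc m / fact (Suc m)) (at s)" for s
    using DERIV_cmult[OF pow[of "Suc m" s], of L]
    by (simp add: \<phi>_def[abs_def] has_real_derivative_iff_has_vector_derivative del: power_Suc fact_Suc)
  have "norm (E t - E 0) \<le> \<phi> t - \<phi> 0"
  proof (cases "t = 0")
    case False
    then have "0 < t" using Suc.prems(3) by simp
    then show ?thesis
    proof (rule differentiable_bound_general)
      show "continuous_on {0..t} E" "continuous_on {0..t} \<phi>"
        using E' \<phi>' by (meson continuous_at_imp_continuous_on has_vector_derivative_continuous)+
    qed (use E' \<phi>' IH in auto)
  qed simp
  moreover have "E 0 = 0" by (simp add: E)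
  ultimately show ?case unfolding E_def \<phi>_def by simp
qed

lemma hderiv_along_line:
  assumes "times_cont_diff m F" and "j < m"
  shows "((\<lambda>t. hderiv F (replicate j u) (v + t *\<^sub>R u)) has_vector_derivative
           hderiv F (replicate (Suc j) u) (v + t *\<^sub>R u)) (at t)"
proof -
  have line: "((\<lambda>t. v + t *\<^sub>R u) has_derivative (\<lambda>s. s *\<^sub>R u)) (at t)"
    by (auto intro!: derivative_eq_intros)
  have der: "(hderiv F (replicate j u) has_derivative
        (\<lambda>h. hderiv F (h # replicate j u) (v + t *\<^sub>R u))) (at (v + t *\<^sub>R u))"
    using assms by (intro hderiv_has_derivative) auto
  show ?thesis
    using has_derivative_compose[OF line der] linear_scale[OF has_derivative_linear[OF der]]
    by (simp del: hderiv.simps add: has_vector_derivative_def)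
qed

text \<open>
  Taylor's formula along the segment from \<open>v\<close> to \<open>y\<close>, parametrised by arc length because the Lipschitz
  bound is available for unit directions only; homogeneity then restores the direction \<open>y - v\<close>.
\<close>

lemma order_smooth_taylor_remainder:
  assumes "order_smooth m L F"
  shows "norm (F y - (\<Sum>j\<le>m. (1 / fact j) *\<^sub>R hderiv F (replicate j (y - v)) v))
           \<le> L * norm (y - v) ^ Suc m / fact (Suc m)"
proof -
  have tcd: "times_cont_diff m F" using assms by (simp add: order_smooth_def)
  define r where "r = norm (y - v)"
  \<comment> \<open>For \<open>y = v\<close> any unit vector serves, since \<open>r = 0\<close>.\<close>
  obtain u where u: "norm u = 1" "y - v = r *\<^sub>R u"
  proof (cases "y = v")
    case True
    then show ?thesis using that[of "SOME b. b \<in> Basis"] by (simp add: r_def some_in_eq nonempty_Basis)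
  next
    case False
    then show ?thesis using that[of "(1 / r) *\<^sub>R (y - v)"] by (simp add: r_def)
  qed
  define G where "G j t = hderiv F (replicate j u) (v + t *\<^sub>R u)" for j t
  have "norm (G m t - G m 0) \<le> L * t" if "t \<ge> 0" for t
    using order_smooth_hderiv_lipschitz[OF assms, of "replicate m u" "v + t *\<^sub>R u" v] u(1) that
    by (simp add: G_def)
  then have "norm (G 0 r - (\<Sum>j\<le>m. (r ^ j / fact j) *\<^sub>R G j 0)) \<le> L * r ^ Suc m / fact (Suc m)"
    by (intro taylor_remainder_lipschitz)
      (use hderiv_along_line[OF tcd] in \<open>auto simp: G_def[abs_def] r_def\<close>)
  moreover have "G 0 r = F y" using u(2) by (simp add: G_def flip: u(2))
  moreover have "(\<Sum>j\<le>m. (r ^ j / fact j) *\<^sub>R G j 0)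
      = (\<Sum>j\<le>m. (1 / fact j) *\<^sub>R hderiv F (replicate j (y - v)) v)"
    by (intro sum.cong) (simp_all add: G_def u(2) hderiv_replicate_scaleR[OF tcd])
  ultimately show ?thesis by (simp add: r_def)
qed

section \<open>Solutions of the variational inequality\<close>

lemma order_smooth_continuous:
  assumes "order_smooth m L F"
  shows "continuous_on UNIV F"
proof (cases m)
  case 0
  then show ?thesis using assms by (auto simp: order_smooth_def times_cont_diff_def dest: spec[of _ "[]"])
next
  case (Suc n)
  have "times_cont_diff m F" using assms by (simp add: order_smooth_def)
  then have "F differentiable (at x)" for x
    using Suc by (auto simp: times_cont_diff_def dest: spec[of _ "[]"])
  then show ?thesis
    by (simp add: continuous_at_imp_continuous_on differentiable_imp_continuous_within)
qed

text \<open>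
  Minty's lemma: test the weak inequality at points \<open>z + t (x - z)\<close> of the segment towards \<open>x\<close>, divide
  by \<open>t\<close>, and let \<open>t\<close> tend to \<open>0\<close>.
\<close>

lemma weak_solution_is_solution:
  assumes cont: "continuous_on UNIV F" and "convex X" and weak: "weak_vi_solution F X z"
  shows "vi_solution F X z"
  unfolding vi_solution_def
proof (intro conjI ballI)
  show z: "z \<in> X" using weak by (simp add: weak_vi_solution_def)
  fix x assume x: "x \<in> X"
  have "((\<lambda>t. F (z + t *\<^sub>R (x - z)) \<bullet> (x - z)) \<longlongrightarrow> F (z + 0 *\<^sub>R (x - z)) \<bullet> (x - z)) (at_right (0::real))"
    by (intro tendsto_intros isCont_tendsto_compose[where g = F])
      (use cont in \<open>auto simp: continuous_on_eq_continuous_at\<close>)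
  moreover have "\<forall>\<^sub>F t in at_right (0::real). 0 \<le> F (z + t *\<^sub>R (x - z)) \<bullet> (x - z)"
    using eventually_at_right_less[of 0] eventually_at_right_real[of 0 "1::real", simplified]
  proof eventually_elim
    case (elim t)
    then have t: "0 < t" "t < 1" by auto
    have "(1 - t) *\<^sub>R z + t *\<^sub>R x \<in> X" using \<open>convex X\<close> z x t by (auto intro: convexD)
    then have "z + t *\<^sub>R (x - z) \<in> X" by (simp add: algebra_simps)
    then have "0 \<le> F (z + t *\<^sub>R (x - z)) \<bullet> (t *\<^sub>R (x - z))"
      using weak by (force simp: weak_vi_solution_def)
    then show ?case using t by (simp add: zero_le_mult_iff)
  qed
  ultimately show "0 \<le> F z \<bullet> (x - z)"
    by (auto dest: tendsto_lowerbound)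
qed

text \<open>
  Strong monotonicity turns the residual of \<open>F\<close> at \<open>y\<close> in the direction of the solution into an error
  bound; this inequality is the only use of strong monotonicity.
\<close>

lemma strongly_monotone_solution_gap:
  assumes "strongly_monotone \<mu> F" and "vi_solution F X xs" and "y \<in> X"
  shows "\<mu> * (norm (y - xs))\<^sup>2 \<le> F y \<bullet> (y - xs)"
proof -
  have "\<mu> * (norm (y - xs))\<^sup>2 \<le> (F y - F xs) \<bullet> (y - xs)" "0 \<le> F xs \<bullet> (y - xs)"
    using assms by (auto simp: strongly_monotone_def vi_solution_def)
  then show ?thesis by (simp add: inner_diff_left)
qed

lemma vi_solution_unique:
  assumes "strongly_monotone \<mu> F" and "\<mu> > 0" and "vi_solution F X xs" and "vi_solution F X z"
  shows "z = xs"
proof -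
  have "\<mu> * (norm (z - xs))\<^sup>2 \<le> F z \<bullet> (z - xs)"
    using assms by (intro strongly_monotone_solution_gap) (auto simp: vi_solution_def)
  moreover have "0 \<le> F z \<bullet> (xs - z)" using assms by (auto simp: vi_solution_def)
  ultimately have "\<mu> * (norm (z - xs))\<^sup>2 \<le> 0" by (simp add: inner_diff_right)
  then show ?thesis using \<open>\<mu> > 0\<close> by (simp add: mult_le_0_iff)
qed

section \<open>Error after one restart\<close>

text \<open>
  With step length \<open>r\<close> and initial error \<open>b\<close>, the positive term loses against the negative one once
  \<open>r\<close> exceeds \<open>2 b\<close>, because \<open>5 p + 1 \<le> 2 (5 p - 2)\<close>. For smaller \<open>r\<close>, bound \<open>r ^ (p - 1)\<close> by
  \<open>(2 b) ^ (p - 1)\<close> and \<open>r (2 b - r)\<close> by \<open>b\<^sup>2\<close>.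
\<close>

lemma step_length_polynomial_bound:
  fixes r b :: real
  assumes "p \<ge> 1" and "r \<ge> 0" and "b \<ge> 0"
  shows "(5 * real p + 1) * r ^ p * b - (5 * real p - 2) * r ^ Suc p
           \<le> (5 * real p - 2) * (2 ^ p * b ^ Suc p)"
proof -
  have "r ^ p * (2 * b - r) \<le> 2 ^ p * b ^ Suc p"
  proof (cases "r \<le> 2 * b")
    case True
    obtain q where q: "p = Suc q" using assms(1) by (cases p) auto
    have "r ^ p * (2 * b - r) = r ^ q * (r * (2 * b - r))" by (simp add: q)
    also have "\<dots> \<le> (2 * b) ^ q * b\<^sup>2"
    proof (rule mult_mono)
      show "r * (2 * b - r) \<le> b\<^sup>2"
        using zero_le_power2[of "r - b"] by (simp add: power2_eq_square algebra_simps)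
      show "r ^ q \<le> (2 * b) ^ q" using assms True by (intro power_mono)
    qed (use assms True in auto)
    also have "\<dots> \<le> 2 ^ p * b ^ Suc p"
      using assms by (simp add: q power_mult_distrib power2_eq_square)
    finally show ?thesis .
  next
    case False
    then have "r ^ p * (2 * b - r) \<le> 0" using assms by (intro mult_nonneg_nonpos) auto
    also have "\<dots> \<le> 2 ^ p * b ^ Suc p" using assms by simp
    finally show ?thesis .
  qed
  then have "(5 * real p - 2) * (r ^ p * (2 * b - r)) \<le> (5 * real p - 2) * (2 ^ p * b ^ Suc p)"
    using assms by (intro mult_left_mono) auto
  moreover have "(5 * real p + 1) * (r ^ p * b) \<le> (2 * (5 * real p - 2)) * (r ^ p * b)"
    using assms by (intro mult_right_mono) auto
  ultimately show ?thesis by (simp add: algebra_simps)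
qed

text \<open>
  Boundedness of \<open>X\<close> makes the supremum in the stopping criterion a genuine one, so that it
  dominates its value at each point of \<open>X\<close>.
\<close>

lemma subproblem_solution_inner_le:
  assumes "subproblem_solution p L F X v y" and "bounded X" and "x \<in> X"
  shows "reg_taylor p L F v y \<bullet> (y - x) \<le> L / fact p * norm (y - v) ^ Suc p"
proof -
  obtain B where B: "\<And>x. x \<in> X \<Longrightarrow> norm x \<le> B" using assms(2) by (auto simp: bounded_iff)
  have "reg_taylor p L F v y \<bullet> (y - x) \<le> norm (reg_taylor p L F v y) * (norm y + B)"
    if "x \<in> X" for x
  proof -
    have "norm (y - x) \<le> norm y + B" using norm_triangle_ineq4[of y x] B[OF that] by simp
    then show ?thesis
      using norm_cauchy_schwarz[of "reg_taylor p L F v y" "y - x"]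
      by (meson mult_left_mono norm_ge_zero order_trans)
  qed
  then have "bdd_above ((\<lambda>x. reg_taylor p L F v y \<bullet> (y - x)) ` X)" by (auto simp: bdd_above_def)
  then have "reg_taylor p L F v y \<bullet> (y - x) \<le> (SUP x\<in>X. reg_taylor p L F v y \<bullet> (y - x))"
    using assms(3) by (intro cSUP_upper)
  with assms(1) show ?thesis by (simp add: subproblem_solution_def)
qed

text \<open>
  Let \<open>r = norm (y - v)\<close> and \<open>b = norm (v - xs)\<close>, and let \<open>P\<close> be the Taylor polynomial at \<open>v\<close>, evaluated
  at \<open>y\<close>. The inner product of \<open>F y\<close> with \<open>y - xs\<close> is split into three parts: the Taylor remainder,
  at most \<open>L / p! r\<^sup>p (r + b)\<close>; the value of the regularised model, at most \<open>L / p! r\<^bsup>p+1\<^esup>\<close> by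
  the accuracy of the subproblem solution; and minus the regularisation, which is at most
  \<open>- 5 p L / p! r\<^bsup>p-1\<^esup> (r\<^sup>2 - r b)\<close>. The sum is \<open>L / p!\<close> times
  \<open>(5 p + 1) r\<^sup>p b - (5 p - 2) r\<^bsup>p+1\<^esup>\<close>, a polynomial bounded in terms of \<open>b\<close> alone.
\<close>

lemma subproblem_solution_contraction:
  assumes "p \<ge> 1" and "L > 0"
    and "bounded X" and smooth: "order_smooth (p - 1) L F"
    and mono: "strongly_monotone \<mu> F" and sol: "vi_solution F X xs"
    and sub: "subproblem_solution p L F X v y"
  shows "\<mu> * (norm (y - xs))\<^sup>2
           \<le> L / fact p * ((5 * real p - 2) * (2 ^ p * norm (v - xs) ^ Suc p))"
proof -
  define r where "r = norm (y - v)"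
  define b where "b = norm (v - xs)"
  define c where "c = 5 * L / fact (p - 1) * r ^ (p - 1)"
  define P where "P = (\<Sum>j\<le>p - 1. (1 / fact j) *\<^sub>R hderiv F (replicate j (y - v)) v)"
  have c: "c \<ge> 0" using assms by (simp add: c_def r_def)
  have pp: "Suc (p - 1) = p" and rp: "r ^ p = r ^ (p - 1) * r"
    and fp: "(fact p :: real) = p * fact (p - 1)"
    using assms(1) by (simp_all add: power_eq_if fact_reduce)
  have reg: "reg_taylor p L F v y = P + c *\<^sub>R (y - v)"
    by (simp add: reg_taylor_def P_def c_def r_def atLeast0AtMost)
  have y: "y \<in> X" using sub by (simp add: subproblem_solution_def)
  have "F y \<bullet> (y - xs)
      = (F y - P) \<bullet> (y - xs) + reg_taylor p L F v y \<bullet> (y - xs) - c * ((y - v) \<bullet> (y - xs))"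
    by (simp add: reg inner_diff_left inner_add_left)
  also have "\<dots> \<le> L / fact p * r ^ p * (r + b) + L / fact p * r ^ Suc p - c * (r\<^sup>2 - r * b)"
  proof (intro diff_mono add_mono mult_left_mono c)
    have "(F y - P) \<bullet> (y - xs) \<le> norm (F y - P) * norm (y - xs)"
      by (rule norm_cauchy_schwarz)
    also have "\<dots> \<le> L / fact p * r ^ p * (r + b)"
    proof (rule mult_mono)
      show "norm (F y - P) \<le> L / fact p * r ^ p"
        using order_smooth_taylor_remainder[OF smooth, of y v] unfolding pp P_def r_def by simp
      show "norm (y - xs) \<le> r + b"
        unfolding r_def b_def using norm_triangle_ineq[of "y - v" "v - xs"] by simp
    qed (use assms in \<open>auto simp: r_def\<close>)
    finally show "(F y - P) \<bullet> (y - xs) \<le> L / fact p * r ^ p * (r + b)" .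
    show "reg_taylor p L F v y \<bullet> (y - xs) \<le> L / fact p * r ^ Suc p"
      unfolding r_def using sub assms(3) sol
      by (intro subproblem_solution_inner_le) (auto simp: vi_solution_def)
    have "(y - v) \<bullet> (xs - v) \<le> r * b"
      unfolding r_def b_def by (metis norm_cauchy_schwarz norm_minus_commute)
    moreover have "(y - v) \<bullet> (y - xs) = (y - v) \<bullet> (y - v) - (y - v) \<bullet> (xs - v)"
      by (simp add: algebra_simps)
    ultimately show "r\<^sup>2 - r * b \<le> (y - v) \<bullet> (y - xs)"
      by (simp add: r_def power2_norm_eq_inner)
  qed
  also have "\<dots> = L / fact p * ((5 * real p + 1) * r ^ p * b - (5 * real p - 2) * r ^ Suc p)"
    using assms(1) by (simp add: c_def fp rp field_simps power2_eq_square)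
  also have "\<dots> \<le> L / fact p * ((5 * real p - 2) * (2 ^ p * b ^ Suc p))"
    using assms(1,2)
    by (intro mult_left_mono step_length_polynomial_bound) (simp_all add: r_def b_def)
  finally show ?thesis
    using strongly_monotone_solution_gap[OF mono sol y] by (simp add: b_def)
qed

text \<open>
  With zero dual variable the regularised linear maximisation is the projection of \<open>x0\<close> to \<open>X\<close>.
\<close>

lemma dual_argmax_zero_eq:
  assumes "dual_argmax X x0 0 v" and "x0 \<in> X"
  shows "v = x0"
proof -
  have "\<not> (- (1/2) * (norm (v - x0))\<^sup>2 < 0)"
    using assms by (auto simp: dual_argmax_def is_arg_max_def dest!: spec[of _ x0])
  then show ?thesis by auto
qed

text \<open>
  Since a fresh run starts with zero dual variable, its single iteration solves the subproblem centred
  at the starting point itself, unless that point is already a solution. The ordinary step and the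
  early stop at \<open>y = v\<close> both give such a subproblem solution.
\<close>

lemma perseus_one_iteration_cases:
  assumes "perseus p L F X x0 1 z" and "x0 \<in> X"
  shows "vi_solution F X x0 \<and> z = x0 \<or> subproblem_solution p L F X x0 z"
proof -
  have "perseus_run p L F X x0 (Suc 0) x0 0 z" using assms(1) by (simp add: perseus_def)
  then show ?thesis
  proof cases
    case (step v y lam)
    from step(8) have "z = y" by cases auto
    with step dual_argmax_zero_eq[OF _ assms(2)] show ?thesis by auto
  qed (use dual_argmax_zero_eq[OF _ assms(2)] in auto)
qed

text \<open>
  Membership of the iterates in \<open>X\<close> has to be carried along, because the projection in the next
  restart fixes only points of \<open>X\<close>. A restart that has stopped sits at the unique solution, where the
  error is zero and the inequality is trivial.
\<close>

lemma perseus_restart_step: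
  assumes "p \<ge> 1" and "L > 0" and "\<mu> > 0"
    and "bounded X" and "order_smooth (p - 1) L F"
    and "strongly_monotone \<mu> F" and "vi_solution F X xs" and "x0 \<in> X"
    and run: "perseus_restart p L F X x0 T x" and "k \<le> T"
  shows "x k \<in> X \<and> \<mu> * (norm (x (Suc k) - xs))\<^sup>2
           \<le> L / fact p * ((5 * real p - 2) * (2 ^ p * norm (x k - xs) ^ Suc p))"
proof -
  have step: "vi_solution F X (x k) \<and> x (Suc k) = x k \<or> subproblem_solution p L F X (x k) (x (Suc k))"
    if "k \<le> T" "x k \<in> X" for k
    using run that perseus_one_iteration_cases[of p L F X "x k" "x (Suc k)"]
    by (auto simp: perseus_restart_def split: if_splits)
  have mem: "x k \<in> X" if "k \<le> Suc T" for k
    using that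
  proof (induction k)
    case 0
    show ?case using run \<open>x0 \<in> X\<close> by (simp add: perseus_restart_def)
  next
    case (Suc k)
    then show ?case using step[of k] by (auto simp: subproblem_solution_def)
  qed
  then show ?thesis
    using step[OF \<open>k \<le> T\<close>] \<open>k \<le> T\<close> vi_solution_unique[OF assms(6,3,7), of "x k"]
      subproblem_solution_contraction[OF assms(1,2,4-7)] by auto
qed

section \<open>Superlinear convergence\<close>

text \<open>
  Below the threshold the error shrinks by a fixed factor \<open>\<rho> < 1\<close>: the contraction factor is increasing
  in the error, so it never exceeds its initial value. Hence the errors tend to \<open>0\<close>, and with them the
  factors \<open>C * e k powr a\<close> that bound the ratios. Where an error is zero, the ratio is zero by the
  convention for division.
\<close>

lemma superlinear_convergence:
  fixes e :: "nat \<Rightarrow> real"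
  assumes C: "C > 0" and a: "a > 0"
    and nonneg: "\<And>k. e k \<ge> 0"
    and step: "\<And>k. e (Suc k) \<le> C * e k powr a * e k"
    and start: "C * e 0 powr a < 1"
  shows "e \<longlonglongrightarrow> 0" and "(\<lambda>k. e (Suc k) / e k) \<longlonglongrightarrow> 0"
proof -
  define \<rho> where "\<rho> = C * e 0 powr a"
  have \<rho>: "0 \<le> \<rho>" "\<rho> < 1" using C start by (simp_all add: \<rho>_def)
  have geo: "e k \<le> \<rho> ^ k * e 0" for k
  proof (induction k)
    case (Suc k)
    \<comment> \<open>The geometric bound keeps \<open>e k\<close> below \<open>e 0\<close>, hence the factor below \<open>\<rho>\<close>.\<close>
    have "\<rho> ^ k * e 0 \<le> e 0"
      using \<rho> nonneg[of 0] by (simp add: mult_left_le_one_le power_le_one)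
    then have "e k \<le> e 0" using Suc by simp
    then have "C * e k powr a \<le> \<rho>"
      unfolding \<rho>_def using C a nonneg by (intro mult_left_mono powr_mono2) auto
    then have "C * e k powr a * e k \<le> \<rho> * (\<rho> ^ k * e 0)"
      using Suc nonneg \<rho> by (intro mult_mono) auto
    then show ?case using step[of k] by simp
  qed simp
  have "(\<lambda>k. \<rho> ^ k * e 0) \<longlonglongrightarrow> 0" using \<rho> by (intro tendsto_mult_left_zero LIMSEQ_realpow_zero)
  then show lim: "e \<longlonglongrightarrow> 0"
    using geo nonneg by (intro tendsto_sandwich[of "\<lambda>_. 0" e _ "\<lambda>k. \<rho> ^ k * e 0"]) auto
  have "norm (e (Suc k) / e k) \<le> C * e k powr a" for k
  proof (cases "e k = 0")
    case False
    then have "e k > 0" using nonneg[of k] by simp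
    then show ?thesis using step[of k] nonneg[of "Suc k"] by (simp add: pos_divide_le_eq)
  qed simp
  then have le: "\<forall>k. norm (e (Suc k) / e k) \<le> C * e k powr a" by blast
  have "(\<lambda>k. e k powr a) \<longlonglongrightarrow> 0"
    using lim a nonneg by (intro tendsto_zero_powrI[where g = "\<lambda>_. a"]) auto
  then have "(\<lambda>k. C * e k powr a) \<longlonglongrightarrow> 0" by (rule tendsto_mult_right_zero)
  with always_eventually[OF le] show "(\<lambda>k. e (Suc k) / e k) \<longlonglongrightarrow> 0"
    by (rule Lim_null_comparison)
qed

theorem theorem3p5:
  fixes p :: nat and L \<mu> \<kappa> D :: real
    and X :: "(real ^ 'd) set" and F :: "real ^ 'd \<Rightarrow> real ^ 'd"
    and xs x0 :: "real ^ 'd"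
  assumes "p \<ge> 1" and "L > 0" and "\<mu> > 0"
    and "closed X" and "convex X" and "bounded X" and "D = diameter X" and "D > 0"
    and "order_smooth (p - 1) L F"
    and "strongly_monotone \<mu> F"
    and "\<kappa> = L / \<mu>"
    and "weak_vi_solution F X xs"
    and "x0 \<in> X"
  shows
    "(\<forall>T x. perseus_restart p L F X x0 T x \<longrightarrow>
        (\<forall>k\<le>T. norm (x (k + 1) - xs)
           \<le> sqrt (2 ^ p * (5 * real p - 2) * \<kappa> / fact p)
              * norm (x k - xs) powr ((real p + 1) / 2)))
     \<and> (p \<ge> 2 \<longrightarrow>
        norm (x0 - xs)
          \<le> 1 / 2 * (fact p / (2 ^ p * (5 * real p - 2) * \<kappa>)) powr (1 / (real p - 1)) \<longrightarrow>
        (\<forall>x. (\<forall>T. perseus_restart p L F X x0 T x) \<longrightarrow>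
           x \<longlonglongrightarrow> xs \<and>
           ((\<forall>\<^sub>F k in sequentially. x k = xs) \<or>
            (\<lambda>k. norm (x (k + 1) - xs) / norm (x k - xs)) \<longlonglongrightarrow> 0)))"
proof -
  define C where "C = 2 ^ p * (5 * real p - 2) * \<kappa> / fact p"
  have C: "C > 0" using assms(1-3,11) by (simp add: C_def)
  have sol: "vi_solution F X xs"
    using assms order_smooth_continuous weak_solution_is_solution by blast
  have bound: "norm (x (k + 1) - xs) \<le> sqrt C * norm (x k - xs) powr ((real p + 1) / 2)"
    if run: "perseus_restart p L F X x0 T x" "k \<le> T" for T x k
  proof -
    let ?b = "norm (x k - xs)"
    have "\<mu> * (norm (x (Suc k) - xs))\<^sup>2 \<le> L / fact p * ((5 * real p - 2) * (2 ^ p * ?b ^ Suc p))"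
      using perseus_restart_step[OF assms(1-3,6,9,10) sol assms(13) run] by blast
    then have "(norm (x (Suc k) - xs))\<^sup>2 \<le> C * ?b ^ Suc p"
      using \<open>\<mu> > 0\<close> unfolding C_def assms(11) by (simp add: field_simps)
    then have "norm (x (Suc k) - xs) \<le> sqrt (C * ?b ^ Suc p)" by (rule real_le_rsqrt)
    also have "\<dots> = sqrt C * ?b powr ((real p + 1) / 2)"
    proof (cases "?b = 0")
      case False
      then have "sqrt (?b ^ Suc p) = ?b powr ((real p + 1) / 2)"
        by (simp add: powr_half_sqrt[symmetric] powr_powr powr_realpow[symmetric] add.commute
            del: power_Suc)
      then show ?thesis by (simp add: real_sqrt_mult)
    qed simp
    finally show ?thesis by simp
  qed
  have "x \<longlonglongrightarrow> xs \<and> (\<lambda>k. norm (x (k + 1) - xs) / norm (x k - xs)) \<longlonglongrightarrow> 0"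
    if p: "p \<ge> 2" and run: "\<forall>T. perseus_restart p L F X x0 T x"
      and close: "norm (x0 - xs)
          \<le> 1 / 2 * (fact p / (2 ^ p * (5 * real p - 2) * \<kappa>)) powr (1 / (real p - 1))" for x
  proof -
    define a where "a = (real p - 1) / 2"
    have a: "a > 0" using p by (simp add: a_def)
    have x0: "x 0 = x0" using run by (auto simp: perseus_restart_def)
    have step: "norm (x (Suc k) - xs) \<le> sqrt C * norm (x k - xs) powr a * norm (x k - xs)" for k
    proof -
      have exponent: "(real p + 1) / 2 = a + 1" by (simp add: a_def field_simps)
      show ?thesis
        using bound[of k x k] run unfolding exponent by (simp add: powr_add mult.assoc)
    qed
    \<comment> \<open>The power \<open>a\<close> turns \<open>(1 / C) powr (1 / (p - 1))\<close> into \<open>1 / sqrt C\<close>, which cancels the constant.\<close>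
    have "norm (x 0 - xs) powr a \<le> (1 / 2 * (1 / C) powr (1 / (real p - 1))) powr a"
      using close a by (intro powr_mono2) (simp_all add: x0 C_def)
    also have "\<dots> = (1 / 2) powr a * (1 / C) powr (1 / (real p - 1) * a)"
      unfolding powr_powr[symmetric] by (rule powr_mult)
    also have "1 / (real p - 1) * a = 1 / 2" using p by (simp add: a_def)
    finally have "sqrt C * norm (x 0 - xs) powr a \<le> sqrt C * ((1 / 2) powr a * (1 / C) powr (1 / 2))"
      using C by (intro mult_left_mono) auto
    also have "\<dots> = (1 / 2) powr a"
      using C by (simp add: powr_half_sqrt real_sqrt_divide)
    also have "\<dots> < 1" using powr_less_mono2[of a "1 / 2" 1] a by simp
    finally have start: "sqrt C * norm (x 0 - xs) powr a < 1" .
    have C': "sqrt C > 0" using C by simp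
    note superlinear_convergence[where e = "\<lambda>k. norm (x k - xs)", OF C' a norm_ge_zero step start]
    moreover from this(1) have "x \<longlonglongrightarrow> xs" by (rule LIM_zero_cancel[OF tendsto_norm_zero_cancel])
    ultimately show ?thesis by simp
  qed
  then show ?thesis using bound unfolding C_def by blast
qed

end
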